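(* Let $\mathbf u$ be a (smooth) solution, with $\rho,p>0$, on a domain $\Omega\subset\mathbb R^3$ with outward unit normal $\vec n$, of the resistive GLM-MHD equations $$\mathbf u_t+\vec\nabla\cdot\mathbf f^a(\mathbf u)-\vec\nabla\cdot\mathbf f^v(\mathbf u,\vec\nabla\mathbf u)+\boldsymbol\Upsilon=\mathbf r,$$ with the non-conservative terms $\boldsymbol\Upsilon=\boldsymbol\Upsilon^{\mathrm{MHD}}+\boldsymbol\Upsilon^{\mathrm{GLM}}$ and the damping source $\mathbf r=(0,0,0,0,0,0,0,0,-\alpha\psi)^T$ with $\alpha\ge0$. Then $\mathbf u$ satisfies the entropy inequality $$\int_\Omega S_t\,\mathrm dV+\int_{\partial\Omega}\Big[(\vec f^{\,S}\cdot\vec n)-\mathbf w^T(\mathbf f^v\cdot\vec n)\Big]\mathrm dS\le 0 .$$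
   Context: State: $\mathbf u=(\rho,\rho\vec v,E,\vec B,\psi)^T\in\mathbb R^9$ with density $\rho$, velocity $\vec v$, total energy $E$, magnetic field $\vec B$, and scalar $\psi$. Pressure: $p=(\gamma-1)\left(E-\tfrac12\rho\|\vec v\|^2-\tfrac12\|\vec B\|^2-\tfrac12\psi^2\right)$, $\gamma>1$. Constants $\mu_{\mathrm{NS}},\mu_{\mathrm R},\kappa,R>0$, GLM wave speed $c_h$ (constant). $\Omega$ is regular enough for the divergence theorem. Write $(x_1,x_2,x_3)=(x,y,z)$, $\partial_\ell=\partial/\partial x_\ell$; $\vec\nabla\cdot\mathbf f=\sum_\ell\partial_\ell\mathbf f_\ell$ and $\mathbf f\cdot\vec n=\sum_\ell n_\ell\mathbf f_\ell$ for $\mathbf f=(\mathbf f_1,\mathbf f_2,\mathbf f_3)$, $\mathbf f_\ell\in\mathbb R^9$. Advective flux in direction $\ell$ (components: mass; momentum $k=1,2,3$; energy; magnetic $k=1,2,3$; $\psi$): $$\mathbf f^a_\ell=\begin{pmatrix}\rho v_\ell\\ \rho v_\ell v_k+p\,\delta_{\ell k}+\tfrac12\|\vec B\|^2\delta_{\ell k}-B_\ell B_k\\ v_\ell\big(\tfrac12\rho\|\vec v\|^2+\tfrac{\gamma p}{\gamma-1}\big)+v_\ell\|\vec B\|^2-B_\ell(\vec v\cdot\vec B)+c_h\psi B_\ell\\ v_\ell B_k-B_\ell v_k+c_h\psi\,\delta_{\ell k}\\ c_hB_\ell\end{pmatrix}.$$ Viscous flux in direction $\ell$: $$\mathbf f^v_\ell=\Big(0,\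 (\tau_{\ell k})_{k=1}^3,\ \sum_{k}\tau_{\ell k}v_k+\kappa\,\partial_\ell\big(\tfrac{p}{R\rho}\big)-\mu_{\mathrm R}\big((\vec\nabla\times\vec B)\times\vec B\big)_\ell,\ \big(\mu_{\mathrm R}(\partial_\ell B_k-\partial_kB_\ell)\big)_{k=1}^3,\ 0\Big)^T,$$ $\tau_{\ell k}=\mu_{\mathrm{NS}}(\partial_\ell v_k+\partial_k v_\ell)-\tfrac23\mu_{\mathrm{NS}}(\vec\nabla\cdot\vec v)\delta_{\ell k}$. Non-conservative terms: $\boldsymbol\Upsilon^{\mathrm{MHD}}=(\vec\nabla\cdot\vec B)\,(0,B_1,B_2,B_3,\vec v\cdot\vec B,v_1,v_2,v_3,0)^T$ and $\boldsymbol\Upsilon^{\mathrm{GLM}}=\sum_{\ell=1}^3(0,0,0,0,v_\ell\psi,0,0,0,v_\ell)^T\,\partial_\ell\psi$. Entropy function: $S(\mathbf u)=-\frac{\rho s}{\gamma-1}$, $s=\ln(p\rho^{-\gamma})$; entropy flux $\vec f^{\,S}=\vec vS$; entropy variables $\mathbf w=\partial S/\partial\mathbf u=\big(\tfrac{\gamma-s}{\gamma-1}-\beta\|\vec v\|^2,2\beta v_1,2\beta v_2,2\beta v_3,-2\beta,2\beta B_1,2\beta B_2,2\beta B_3,2\beta\psi\big)^T$, $\beta=\frac{\rho}{2p}$. *)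

theory Defs
  imports "HOL-Analysis.Analysis"
begin

subsection \<open>Calculus on open sets\<close>

text \<open>\<open>Ck_on k U f\<close>: on the open set \<open>U\<close>, \<open>f\<close> is \<open>k\<close> times continuously differentiable.\<close>

primrec Ck_on :: "nat \<Rightarrow> 'a::euclidean_space set \<Rightarrow> ('a \<Rightarrow> 'b::real_normed_vector) \<Rightarrow> bool" where
  "Ck_on 0 U f \<longleftrightarrow> continuous_on U f"
| "Ck_on (Suc k) U f \<longleftrightarrow> (\<forall>x\<in>U. f differentiable (at x)) \<and>
     (\<forall>i\<in>Basis. Ck_on k U (\<lambda>x. frechet_derivative f (at x) i))"

text \<open>For differentiable \<open>f\<close> this is the classical partial derivative in direction \<open>l\<close>.\<close>

definition partial :: "3 \<Rightarrow> (real^3 \<Rightarrow> 'b::real_normed_vector) \<Rightarrow> real^3 \<Rightarrow> 'b" where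
  "partial l f x = frechet_derivative f (at x) (axis l 1)"

text \<open>The argument \<open>F l\<close> is the flux in direction \<open>l\<close>; it may be vector-valued.\<close>

definition divergence :: "(3 \<Rightarrow> real^3 \<Rightarrow> 'b::real_normed_vector) \<Rightarrow> real^3 \<Rightarrow> 'b" where
  "divergence F x = (\<Sum>l\<in>UNIV. partial l (F l) x)"

definition vdiv :: "(real^3 \<Rightarrow> real^3) \<Rightarrow> real^3 \<Rightarrow> real" where
  "vdiv F = divergence (\<lambda>l y. F y $ l)"

definition curl :: "(real^3 \<Rightarrow> real^3) \<Rightarrow> real^3 \<Rightarrow> real^3" where
  "curl F x = vector
     [partial 2 (\<lambda>y. F y $ 3) x - partial 3 (\<lambda>y. F y $ 2) x,
      partial 3 (\<lambda>y. F y $ 1) x - partial 1 (\<lambda>y. F y $ 3) x,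
      partial 1 (\<lambda>y. F y $ 2) x - partial 2 (\<lambda>y. F y $ 1) x]"


subsection \<open>Surface measure, outward normals and the divergence theorem\<close>

text \<open>
  The surface element \<open>dS\<close> is two-dimensional Hausdorff measure on \<open>\<real>\<^sup>3\<close>, with the factor
  \<open>\<pi>/4\<close> that makes it agree with Lebesgue area on planes. The outer measure \<open>H2_outer\<close> is
  a metric outer measure and hence countably additive on the Borel sets, so that
  \<open>surface_measure\<close> coincides with it there. Covering sets are required to be
  bounded because \<open>diameter\<close> is not meaningful for unbounded sets.
\<close>

definition H2_approx :: "real \<Rightarrow> (real^3) set \<Rightarrow> ennreal" where
  "H2_approx \<delta> A =
     (INF C \<in> {C :: nat \<Rightarrow> (real^3) set. A \<subseteq> (\<Union>i. C i) \<and> (\<forall>i. bounded (C i) \<and> diameter (C i) \<le> \<delta>)}.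
        (\<Sum>i. ennreal (pi / 4 * (diameter (C i))\<^sup>2)))"

definition H2_outer :: "(real^3) set \<Rightarrow> ennreal" where
  "H2_outer A = (SUP \<delta>\<in>{0<..}. H2_approx \<delta> A)"

definition surface_measure :: "(real^3) measure" where
  "surface_measure = measure_of UNIV (sets borel) H2_outer"

text \<open>
  The unit vector \<open>\<nu>\<close> is the outward normal of \<open>\<Omega>\<close> at the boundary point \<open>x\<close> if the boundary has
  the tangent plane \<open>x + \<nu>\<^sup>\<bottom>\<close> at \<open>x\<close>, with \<open>\<Omega>\<close> on the side of \<open>-\<nu>\<close> and the complement of \<open>\<Omega>\<close> on
  the side of \<open>\<nu>\<close>, up to an error \<open>o(dist y x)\<close>.
\<close>

definition outward_unit_normal_at :: "(real^3) set \<Rightarrow> real^3 \<Rightarrow> real^3 \<Rightarrow> bool" where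
  "outward_unit_normal_at \<Omega> x \<nu> \<longleftrightarrow> norm \<nu> = 1 \<and>
     (\<forall>\<epsilon>>0. \<forall>\<^sub>F y in nhds x.
        (y \<in> \<Omega> \<longrightarrow> (y - x) \<bullet> \<nu> \<le> \<epsilon> * dist y x) \<and>
        (y \<notin> \<Omega> \<longrightarrow> (y - x) \<bullet> \<nu> \<ge> - \<epsilon> * dist y x))"

text \<open>Edges and corners, where there is no normal, are allowed as a null set.\<close>

definition outward_unit_normal :: "(real^3) set \<Rightarrow> (real^3 \<Rightarrow> real^3) \<Rightarrow> bool" where
  "outward_unit_normal \<Omega> n \<longleftrightarrow>
     (AE x in surface_measure. x \<in> frontier \<Omega> \<longrightarrow> outward_unit_normal_at \<Omega> x (n x))"

definition divergence_theorem_holds :: "(real^3) set \<Rightarrow> (real^3 \<Rightarrow> real^3) \<Rightarrow> bool" where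
  "divergence_theorem_holds \<Omega> n \<longleftrightarrow>
     (\<forall>U F. open U \<longrightarrow> closure \<Omega> \<subseteq> U \<longrightarrow> Ck_on 1 U F \<longrightarrow>
        set_integrable surface_measure (frontier \<Omega>) (\<lambda>x. F x \<bullet> n x) \<and>
        (LINT x:\<Omega>|lborel. vdiv F x) = (LINT x:frontier \<Omega>|surface_measure. F x \<bullet> n x))"


subsection \<open>States\<close>

text \<open>
  A state \<open>(\<rho>, \<rho>v, E, B, \<psi>)\<close> is an element of \<open>\<real>\<^sup>9\<close>, kept in its block structure; the inner
  product of the product type is the Euclidean one.
\<close>

type_synonym state = "real \<times> (real^3) \<times> real \<times> (real^3) \<times> real"

lemma DIM_state: "DIM(state) = 9"
  by simp

definition mass_density :: "state \<Rightarrow> real" where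
  "mass_density = (\<lambda>(\<rho>, m, E, B, \<psi>). \<rho>)"

definition velocity :: "state \<Rightarrow> real^3" where
  "velocity = (\<lambda>(\<rho>, m, E, B, \<psi>). (1 / \<rho>) *\<^sub>R m)"

definition energy :: "state \<Rightarrow> real" where
  "energy = (\<lambda>(\<rho>, m, E, B, \<psi>). E)"

definition magnetic :: "state \<Rightarrow> real^3" where
  "magnetic = (\<lambda>(\<rho>, m, E, B, \<psi>). B)"

definition psi :: "state \<Rightarrow> real" where
  "psi = (\<lambda>(\<rho>, m, E, B, \<psi>). \<psi>)"

definition pressure :: "real \<Rightarrow> state \<Rightarrow> real" where
  "pressure \<gamma> u = (\<gamma> - 1) *
     (energy u - mass_density u * (norm (velocity u))\<^sup>2 / 2 - (norm (magnetic u))\<^sup>2 / 2 - (psi u)\<^sup>2 / 2)"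


subsection \<open>Fluxes, non-conservative terms and source\<close>

definition advective_flux :: "real \<Rightarrow> real \<Rightarrow> 3 \<Rightarrow> state \<Rightarrow> state" where
  "advective_flux \<gamma> c\<^sub>h l u =
     (let \<rho> = mass_density u; v = velocity u; p = pressure \<gamma> u; B = magnetic u; \<psi> = psi u in
       (\<rho> * v $ l,
        (\<chi> k. \<rho> * v $ l * v $ k + p * of_bool (l = k)
              + (norm B)\<^sup>2 / 2 * of_bool (l = k) - B $ l * B $ k),
        v $ l * (\<rho> * (norm v)\<^sup>2 / 2 + \<gamma> * p / (\<gamma> - 1)) + v $ l * (norm B)\<^sup>2
          - B $ l * (v \<bullet> B) + c\<^sub>h * \<psi> * B $ l,
        (\<chi> k. v $ l * B $ k - B $ l * v $ k + c\<^sub>h * \<psi> * of_bool (l = k)),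
        c\<^sub>h * B $ l))"

definition stress :: "real \<Rightarrow> (real^3 \<Rightarrow> real^3) \<Rightarrow> real^3 \<Rightarrow> 3 \<Rightarrow> 3 \<Rightarrow> real" where
  "stress \<mu>\<^sub>N\<^sub>S v x l k =
     \<mu>\<^sub>N\<^sub>S * (partial l (\<lambda>y. v y $ k) x + partial k (\<lambda>y. v y $ l) x)
     - 2 / 3 * \<mu>\<^sub>N\<^sub>S * vdiv v x * of_bool (l = k)"

definition viscous_flux ::
    "real \<Rightarrow> real \<Rightarrow> real \<Rightarrow> real \<Rightarrow> real \<Rightarrow> 3 \<Rightarrow> (real^3 \<Rightarrow> state) \<Rightarrow> real^3 \<Rightarrow> state" where
  "viscous_flux \<gamma> \<mu>\<^sub>N\<^sub>S \<mu>\<^sub>R \<kappa> R l U x =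
     (let v = (\<lambda>y. velocity (U y)); B = (\<lambda>y. magnetic (U y)); \<tau> = stress \<mu>\<^sub>N\<^sub>S v x in
       (0,
        (\<chi> k. \<tau> l k),
        (\<Sum>k\<in>UNIV. \<tau> l k * v x $ k)
          + \<kappa> * partial l (\<lambda>y. pressure \<gamma> (U y) / (R * mass_density (U y))) x
          - \<mu>\<^sub>R * cross3 (curl B x) (B x) $ l,
        (\<chi> k. \<mu>\<^sub>R * (partial l (\<lambda>y. B y $ k) x - partial k (\<lambda>y. B y $ l) x)),
        0))"

definition nonconservative_MHD :: "(real^3 \<Rightarrow> state) \<Rightarrow> real^3 \<Rightarrow> state" where
  "nonconservative_MHD U x =
     (let v = velocity (U x); B = magnetic (U x) in
       vdiv (\<lambda>y. magnetic (U y)) x *\<^sub>R (0, B, v \<bullet> B, v, 0))"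

definition nonconservative_GLM :: "(real^3 \<Rightarrow> state) \<Rightarrow> real^3 \<Rightarrow> state" where
  "nonconservative_GLM U x =
     (\<Sum>l\<in>UNIV. partial l (\<lambda>y. psi (U y)) x *\<^sub>R
        (0, 0, velocity (U x) $ l * psi (U x), 0, velocity (U x) $ l))"

definition damping_source :: "real \<Rightarrow> state \<Rightarrow> state" where
  "damping_source \<alpha> u = (0, 0, 0, 0, - \<alpha> * psi u)"

definition resistive_GLM_MHD_at ::
    "real \<Rightarrow> real \<Rightarrow> real \<Rightarrow> real \<Rightarrow> real \<Rightarrow> real \<Rightarrow> real \<Rightarrow> (real \<Rightarrow> real^3 \<Rightarrow> state) \<Rightarrow> real \<Rightarrow> real^3 \<Rightarrow> bool"
  where
  "resistive_GLM_MHD_at \<gamma> c\<^sub>h \<mu>\<^sub>N\<^sub>S \<mu>\<^sub>R \<kappa> R \<alpha> u t x \<longleftrightarrow>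
     vector_derivative (\<lambda>\<tau>. u \<tau> x) (at t)
     + divergence (\<lambda>l y. advective_flux \<gamma> c\<^sub>h l (u t y)) x
     - divergence (\<lambda>l. viscous_flux \<gamma> \<mu>\<^sub>N\<^sub>S \<mu>\<^sub>R \<kappa> R l (u t)) x
     + (nonconservative_MHD (u t) x + nonconservative_GLM (u t) x)
     = damping_source \<alpha> (u t x)"


subsection \<open>Entropy\<close>

definition specific_entropy :: "real \<Rightarrow> state \<Rightarrow> real" where
  "specific_entropy \<gamma> u = ln (pressure \<gamma> u * mass_density u powr (- \<gamma>))"

definition entropy_fun :: "real \<Rightarrow> state \<Rightarrow> real" where
  "entropy_fun \<gamma> u = - (mass_density u * specific_entropy \<gamma> u) / (\<gamma> - 1)"

definition entropy_flux :: "real \<Rightarrow> state \<Rightarrow> real^3" where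
  "entropy_flux \<gamma> u = entropy_fun \<gamma> u *\<^sub>R velocity u"

definition entropy_vars :: "real \<Rightarrow> state \<Rightarrow> state" where
  "entropy_vars \<gamma> u =
     (let v = velocity u; B = magnetic u; \<beta> = mass_density u / (2 * pressure \<gamma> u) in
       ((\<gamma> - specific_entropy \<gamma> u) / (\<gamma> - 1) - \<beta> * (norm v)\<^sup>2,
        (2 * \<beta>) *\<^sub>R v,
        - 2 * \<beta>,
        (2 * \<beta>) *\<^sub>R B,
        2 * \<beta> * psi u))"

text \<open>The entropy variables are the gradient of the entropy with respect to the state.\<close>

lemma GDERIV_entropy:
  assumes g: "\<gamma> > 1" and r: "mass_density u > 0" and p: "pressure \<gamma> u > 0"
  shows "GDERIV (entropy_fun \<gamma>) u :> entropy_vars \<gamma> u"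
proof -
  define m :: "state \<Rightarrow> real^3" where "m = (\<lambda>w. fst (snd w))"
  have dens: "mass_density w = fst w" and mag: "magnetic w = fst (snd (snd (snd w)))"
    and ps: "psi w = snd (snd (snd (snd w)))" and en: "energy w = fst (snd (snd w))"
    and vel: "velocity w = (1 / fst w) *\<^sub>R m w" for w
    by (simp_all add: mass_density_def magnetic_def psi_def energy_def velocity_def m_def split: prod.split)
  have pr: "pressure \<gamma> w = (\<gamma> - 1) * (energy w - (m w \<bullet> m w) / (2 * mass_density w)
      - (magnetic w \<bullet> magnetic w) / 2 - (psi w * psi w) / 2)" for w
    unfolding pressure_def vel dens
    by (cases "fst w = 0") (simp_all add: dot_square_norm power2_eq_square field_simps)
  define dp where "dp h = (\<gamma> - 1) * (fst (snd (snd h)) - velocity u \<bullet> m h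
      + (velocity u \<bullet> velocity u) / 2 * fst h - magnetic u \<bullet> magnetic h - psi u * psi h)" for h
  have r': "fst u \<noteq> 0" "fst u > 0" using r by (simp_all add: dens)
  have P: "(pressure \<gamma> has_derivative dp) (at u)"
    unfolding pr[abs_def] dp_def[abs_def] dens mag ps en vel m_def
    using r' by (auto intro!: derivative_eq_intros simp: field_simps inner_commute power2_eq_square)
  have D: "(mass_density has_derivative fst) (at u)"
    unfolding dens[abs_def] by (auto intro!: derivative_eq_intros)
  have s_eq: "specific_entropy \<gamma> w = ln (pressure \<gamma> w) - \<gamma> * ln (mass_density w)"
    if "mass_density w > 0" "pressure \<gamma> w > 0" for w
    using that by (simp add: specific_entropy_def ln_mult ln_powr)
  have "((\<lambda>w. - (mass_density w * (ln (pressure \<gamma> w) - \<gamma> * ln (mass_density w))) / (\<gamma> - 1))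
      has_derivative (\<lambda>h. - (fst h * specific_entropy \<gamma> u
        + mass_density u * (dp h / pressure \<gamma> u - \<gamma> * (fst h / mass_density u))) / (\<gamma> - 1))) (at u)"
    using r p g by (auto intro!: derivative_eq_intros P D simp: s_eq divide_simps)
  also have "(\<lambda>h. - (fst h * specific_entropy \<gamma> u
        + mass_density u * (dp h / pressure \<gamma> u - \<gamma> * (fst h / mass_density u))) / (\<gamma> - 1))
      = (\<lambda>h. inner h (entropy_vars \<gamma> u))"
  proof (rule ext)
    fix h :: state
    have v: "(norm (velocity u))\<^sup>2 = velocity u \<bullet> velocity u"
      by (simp add: power2_norm_eq_inner)
    have "dp h / pressure \<gamma> u / (\<gamma> - 1) = (fst (snd (snd h)) - velocity u \<bullet> m h
      + (velocity u \<bullet> velocity u) / 2 * fst h - magnetic u \<bullet> magnetic h - psi u * psi h) / pressure \<gamma> u"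
      using g by (simp add: dp_def)
    moreover have "- (fst h * specific_entropy \<gamma> u
        + mass_density u * (dp h / pressure \<gamma> u - \<gamma> * (fst h / mass_density u))) / (\<gamma> - 1)
      = fst h * ((\<gamma> - specific_entropy \<gamma> u) / (\<gamma> - 1)) - mass_density u * (dp h / pressure \<gamma> u / (\<gamma> - 1))"
      using r p g by (simp add: divide_simps) (simp add: algebra_simps)
    moreover have "inner h (entropy_vars \<gamma> u) = fst h * ((\<gamma> - specific_entropy \<gamma> u) / (\<gamma> - 1))
      - mass_density u * ((fst (snd (snd h)) - velocity u \<bullet> m h
      + (velocity u \<bullet> velocity u) / 2 * fst h - magnetic u \<bullet> magnetic h - psi u * psi h) / pressure \<gamma> u)"
      unfolding entropy_vars_def Let_def v inner_prod_def mag ps m_def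
      using p by (simp add: inner_commute field_simps)
    ultimately show "- (fst h * specific_entropy \<gamma> u
        + mass_density u * (dp h / pressure \<gamma> u - \<gamma> * (fst h / mass_density u))) / (\<gamma> - 1)
      = inner h (entropy_vars \<gamma> u)" by simp
  qed
  finally have "((\<lambda>w. - (mass_density w * (ln (pressure \<gamma> w) - \<gamma> * ln (mass_density w))) / (\<gamma> - 1))
      has_derivative (\<lambda>h. inner h (entropy_vars \<gamma> u))) (at u)" .
  moreover have "\<forall>\<^sub>F w in nhds u. mass_density w > 0 \<and> pressure \<gamma> w > 0"
  proof -
    have "isCont mass_density u" "isCont (pressure \<gamma>) u"
      using P D has_derivative_continuous by blast+
    then show ?thesis
      using r p by (intro eventually_conj) (auto intro: order_tendstoD(1) simp: isCont_def tendsto_at_iff_tendsto_nhds)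
  qed
  then have "\<forall>\<^sub>F w in nhds u. - (mass_density w * (ln (pressure \<gamma> w) - \<gamma> * ln (mass_density w))) / (\<gamma> - 1)
      = entropy_fun \<gamma> w"
    by eventually_elim (simp add: entropy_fun_def s_eq)
  moreover from this have "- (mass_density u * (ln (pressure \<gamma> u) - \<gamma> * ln (mass_density u))) / (\<gamma> - 1)
      = entropy_fun \<gamma> u"
    by (rule eventually_nhds_x_imp_x)
  ultimately show ?thesis
    unfolding gderiv_def
    by (elim has_derivative_transform_eventually)
      (auto simp: eventually_at_filter elim: eventually_mono)
qed

end

theory Submission
  imports Defs
begin

text \<open>
  The equation is contracted with the entropy variables \<open>w\<close>, the gradient of the entropy
  \<open>S\<close>.  At each point of the domain three things happen.

  \<^item> By the chain rule, \<open>w \<bullet> u\<^sub>t = S\<^sub>t\<close> (\<open>entropy_time_derivative\<close>).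

  \<^item> The advective flux together with the non-conservative terms contracts to the divergence of
    the entropy flux \<open>S v\<close>: the hydrodynamic part gives \<open>div (S v)\<close>, as for the Euler
    equations; the magnetic part leaves a multiple of \<open>div B\<close>, which the MHD term removes; the
    terms with the wave speed cancel among each other; and the GLM term is orthogonal to \<open>w\<close>.
    This already happens separately in each coordinate direction
    (\<open>advective_entropy_compatibility\<close>).

  \<^item> By the product rule \<open>w \<bullet> \<partial>\<^sub>l f\<^sup>v\<^sub>l = \<partial>\<^sub>l (w \<bullet> f\<^sup>v\<^sub>l) - \<partial>\<^sub>l w \<bullet> f\<^sup>v\<^sub>l\<close>,
    and the sum over \<open>l\<close> of the last products is non-negative.  With the temperature
    \<open>T = p / (R \<rho>)\<close> it is a sum of viscous heating \<open>\<tau> : \<nabla>v / (R T)\<close>, heat conduction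
    \<open>\<kappa> |\<nabla>T|\<^sup>2 / (R T\<^sup>2)\<close> and Joule heating \<open>\<mu>\<^sub>R |curl B|\<^sup>2 / (R T)\<close>
    (\<open>viscous_entropy_dissipation\<close>).

  As the damping source contributes \<open>- \<alpha> \<rho> \<psi>\<^sup>2 / p \<le> 0\<close>, the vector field
  \<open>F\<^sub>l = S v\<^sub>l - w \<bullet> f\<^sup>v\<^sub>l\<close> satisfies \<open>S\<^sub>t + div F \<le> 0\<close>
  (\<open>pointwise_entropy_inequality\<close>).  Integrating over the domain and applying the divergence
  theorem to \<open>F\<close> gives the claim.  For this \<open>F\<close> has to be continuously differentiable on a
  neighbourhood of the closure of the domain.  The viscous flux uses up one of the two derivatives
  of the solution, and all quantities are smooth where density and pressure are positive; the
  closure properties of \<open>Ck_on\<close> make this precise.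
\<close>

section \<open>Functions of class \<open>C\<^sup>k\<close>\<close>

text \<open>
  The Frechet derivative at a point of an open set depends only on the values on that set.  This is
  what lets every closure property below replace the chosen derivative by an explicit formula.
\<close>

lemma Ck_on_cong:
  assumes "open U" "Ck_on k U f" "\<And>x. x \<in> U \<Longrightarrow> f x = g x"
  shows "Ck_on k U g"
  using assms(2,3)
proof (induction k arbitrary: f g)
  case 0
  then show ?case by (simp cong: continuous_on_cong)
next
  case (Suc k)
  have g: "(g has_derivative frechet_derivative f (at x)) (at x)" if "x \<in> U" for x
    using has_derivative_transform_within_open[of f _ x UNIV U g] Suc.prems that \<open>open U\<close>
    by (auto simp: frechet_derivative_works)
  then have "frechet_derivative g (at x) = frechet_derivative f (at x)" if "x \<in> U" for x
    using that frechet_derivative_at by metis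
  then show ?case
    using Suc g by (fastforce simp: differentiable_def)
qed

lemma Ck_on_SucI:
  assumes "open U" "\<And>x. x \<in> U \<Longrightarrow> (f has_derivative f' x) (at x)"
    and "\<And>i. i \<in> Basis \<Longrightarrow> Ck_on k U (\<lambda>x. f' x i)"
  shows "Ck_on (Suc k) U f"
proof -
  have "frechet_derivative f (at x) = f' x" if "x \<in> U" for x
    using assms(2)[OF that] frechet_derivative_at by metis
  moreover from this have "Ck_on k U (\<lambda>x. frechet_derivative f (at x) i)" if "i \<in> Basis" for i
    using Ck_on_cong[OF assms(1) assms(3)[OF that]] by simp
  ultimately show ?thesis
    using assms(2) by (auto simp: differentiable_def)
qed

lemma Ck_on_has_derivative:
  assumes "Ck_on (Suc k) U f" "x \<in> U"
  shows "(f has_derivative frechet_derivative f (at x)) (at x)"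
  using assms by (auto simp: frechet_derivative_works)

lemma Ck_on_Suc_continuous: "Ck_on (Suc k) U f \<Longrightarrow> continuous_on U f"
  by (simp add: continuous_at_imp_continuous_on differentiable_imp_continuous_within)

lemma Ck_on_lower: "Ck_on (Suc k) U f \<Longrightarrow> Ck_on k U f"
proof (induction k arbitrary: f)
  case 0
  then show ?case using Ck_on_Suc_continuous[OF 0] by simp
qed auto

lemma Ck_on_subset: "Ck_on k U f \<Longrightarrow> V \<subseteq> U \<Longrightarrow> Ck_on k V f"
  by (induction k arbitrary: f) (auto intro: continuous_on_subset)

lemma Ck_on_continuous: "Ck_on k U f \<Longrightarrow> continuous_on U f"
  by (cases k) (simp, blast intro: Ck_on_Suc_continuous)

lemma Ck_on_const: "open U \<Longrightarrow> Ck_on k U (\<lambda>x. c)"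
proof (induction k arbitrary: c)
  case (Suc k)
  then show ?case by (auto intro!: Ck_on_SucI[OF _ has_derivative_const])
qed simp

lemma Ck_on_linear:
  assumes "open U" "bounded_linear L"
  shows "Ck_on k U f \<Longrightarrow> Ck_on k U (\<lambda>x. L (f x))"
proof (induction k arbitrary: f)
  case 0
  then show ?case using assms by (auto intro: bounded_linear.continuous_on)
next
  case (Suc k)
  show ?case
    by (rule Ck_on_SucI[OF \<open>open U\<close>
          bounded_linear.has_derivative[OF assms(2) Ck_on_has_derivative[OF Suc.prems]]])
      (use Suc in auto)
qed

lemma Ck_on_add:
  assumes "open U"
  shows "Ck_on k U f \<Longrightarrow> Ck_on k U g \<Longrightarrow> Ck_on k U (\<lambda>x. f x + g x)"
proof (induction k arbitrary: f g)
  case 0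
  then show ?case by (auto intro: continuous_intros)
next
  case (Suc k)
  show ?case
    by (rule Ck_on_SucI[OF \<open>open U\<close> has_derivative_add[OF Suc.prems[THEN Ck_on_has_derivative]]])
      (use Suc in auto)
qed

lemma Ck_on_sum:
  assumes "open U" "\<And>i. i \<in> I \<Longrightarrow> Ck_on k U (f i)"
  shows "Ck_on k U (\<lambda>x. \<Sum>i\<in>I. f i x)"
  using assms by (induction I rule: infinite_finite_induct) (auto intro: Ck_on_const Ck_on_add)

text \<open>
  By induction on the order: the derivative of the product is a sum of products of a factor with a
  derivative of the other factor, hence one order less regular than the factors.
\<close>

lemma Ck_on_bilinear:
  assumes "open U" "bounded_bilinear P"
  shows "Ck_on k U f \<Longrightarrow> Ck_on k U g \<Longrightarrow> Ck_on k U (\<lambda>x. P (f x) (g x))"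
proof (induction k arbitrary: f g)
  case 0
  then show ?case using assms by (auto intro: bounded_bilinear.continuous_on)
next
  case (Suc k)
  note low = Suc.prems[THEN Ck_on_lower]
  show ?case
    by (rule Ck_on_SucI[OF \<open>open U\<close>
          bounded_bilinear.FDERIV[OF assms(2) Suc.prems[THEN Ck_on_has_derivative]]])
      (use Suc low in \<open>auto intro!: Ck_on_add \<open>open U\<close>\<close>)
qed

lemmas Ck_on_mult = Ck_on_bilinear[OF _ bounded_bilinear_mult]
lemmas Ck_on_scaleR = Ck_on_bilinear[OF _ bounded_bilinear_scaleR]
lemmas Ck_on_inner = Ck_on_bilinear[OF _ bounded_bilinear_inner]
lemmas Ck_on_minus = Ck_on_linear[OF _ bounded_linear_minus[OF bounded_linear_ident]]
lemmas Ck_on_nth = Ck_on_linear[OF _ bounded_linear_vec_nth]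
lemmas Ck_on_fst = Ck_on_linear[OF _ bounded_linear_fst]
lemmas Ck_on_snd = Ck_on_linear[OF _ bounded_linear_snd]

lemma Ck_on_diff:
  assumes "open U" "Ck_on k U f" "Ck_on k U g"
  shows "Ck_on k U (\<lambda>x. f x - g x)"
  using Ck_on_add[OF assms(1,2) Ck_on_minus[OF assms(1,3)]] by simp

lemma Ck_on_Pair:
  assumes "open U" "Ck_on k U f" "Ck_on k U g"
  shows "Ck_on k U (\<lambda>x. (f x, g x))"
proof -
  have l: "bounded_linear (\<lambda>a. (a, 0))" "bounded_linear (\<lambda>b. (0, b))"
    by (intro bounded_linear_Pair bounded_linear_ident bounded_linear_zero)+
  show ?thesis
    using Ck_on_add[OF assms(1) Ck_on_linear[OF assms(1) l(1) assms(2)] Ck_on_linear[OF assms(1) l(2) assms(3)]]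
    by simp
qed

lemma Ck_on_vec_lambda:
  fixes f :: "'n::finite \<Rightarrow> 'a::euclidean_space \<Rightarrow> real"
  assumes "open U" "\<And>i. Ck_on k U (f i)"
  shows "Ck_on k U (\<lambda>x. \<chi> i. f i x)"
proof -
  have "(\<chi> i. f i x) = (\<Sum>i\<in>UNIV. f i x *\<^sub>R axis i 1)" for x
    by (simp add: vec_eq_iff axis_def if_distrib cong: if_cong)
  then show ?thesis
    using assms by (auto intro!: Ck_on_sum Ck_on_scaleR Ck_on_const)
qed

text \<open>
  By induction on the order, because the derivative of \<open>1 / f\<close> is \<open>- f' / f\<^sup>2\<close>, a product of
  functions that the induction hypothesis covers.
\<close>

lemma Ck_on_inverse:
  fixes f :: "'a::euclidean_space \<Rightarrow> real"
  assumes "open U" "\<And>x. x \<in> U \<Longrightarrow> f x \<noteq> 0"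
  shows "Ck_on k U f \<Longrightarrow> Ck_on k U (\<lambda>x. inverse (f x))"
proof (induction k)
  case 0
  then show ?case using assms by (auto intro!: continuous_intros)
next
  case (Suc k)
  note low = Suc.IH[OF Ck_on_lower[OF Suc.prems]]
  show ?case
    by (rule Ck_on_SucI[OF \<open>open U\<close> Deriv.has_derivative_inverse[OF _ Ck_on_has_derivative[OF Suc.prems]]])
      (use Suc.prems low assms in \<open>auto intro!: Ck_on_minus Ck_on_mult\<close>)
qed

lemma Ck_on_divide:
  fixes f g :: "'a::euclidean_space \<Rightarrow> real"
  assumes "open U" "Ck_on k U f" "Ck_on k U g" "\<And>x. x \<in> U \<Longrightarrow> g x \<noteq> 0"
  shows "Ck_on k U (\<lambda>x. f x / g x)"
  unfolding divide_inverse by (intro Ck_on_mult Ck_on_inverse assms)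

lemma Ck_on_ln:
  fixes f :: "'a::euclidean_space \<Rightarrow> real"
  assumes "open U" "\<And>x. x \<in> U \<Longrightarrow> f x > 0" and f: "Ck_on k U f"
  shows "Ck_on k U (\<lambda>x. ln (f x))"
proof (cases k)
  case 0
  then show ?thesis using assms by (force intro!: continuous_intros)
next
  case (Suc j)
  note f = f[unfolded Suc]
  have nz: "f x \<noteq> 0" if "x \<in> U" for x using assms(2)[OF that] by simp
  show ?thesis
    unfolding Suc
    by (rule Ck_on_SucI[OF \<open>open U\<close> has_derivative_ln[OF _ Ck_on_has_derivative[OF f]]])
      (use assms nz f Ck_on_lower[OF f] in \<open>auto intro!: Ck_on_mult Ck_on_inverse\<close>)
qed

lemma Ck_on_partial:
  assumes "Ck_on (Suc k) U f"
  shows "Ck_on k U (partial l f)"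
  using assms by (auto simp: partial_def[abs_def] axis_in_Basis_iff)

text \<open>
  Fixing the time variable: the derivatives of \<open>x \<mapsto> G (t, x)\<close> are those of \<open>G\<close> along the basis
  vectors \<open>(0, i)\<close>.
\<close>

lemma Ck_on_slice:
  fixes G :: "'a::euclidean_space \<times> 'b::euclidean_space \<Rightarrow> 'c::real_normed_vector"
  assumes "open U" "t \<in> T"
  shows "Ck_on k (T \<times> U) G \<Longrightarrow> Ck_on k U (\<lambda>x. G (t, x))"
proof (induction k arbitrary: G)
  case 0
  then show ?case using assms
    by (auto intro!: continuous_on_compose2[of "T \<times> U" G] continuous_intros)
next
  case (Suc k)
  have "((\<lambda>x. G (t, x)) has_derivative (\<lambda>h. frechet_derivative G (at (t, x)) (0, h))) (at x)" if "x \<in> U" for x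
  proof -
    have "((\<lambda>x. (t, x)) has_derivative (\<lambda>h. (0, h))) (at x)"
      by (auto intro!: derivative_eq_intros)
    moreover have "(G has_derivative frechet_derivative G (at (t, x))) (at (t, x))"
      using Ck_on_has_derivative[OF Suc.prems] that assms by auto
    ultimately show ?thesis
      using has_derivative_compose[of "\<lambda>x. (t, x)" _ x UNIV G] by simp
  qed
  moreover have "Ck_on k U (\<lambda>x. frechet_derivative G (at (t, x)) (0, i))" if "i \<in> Basis" for i
    using that Suc.prems by (intro Suc.IH) (auto simp: Basis_prod_def)
  ultimately show ?case
    by (rule Ck_on_SucI[OF \<open>open U\<close>])
qed

section \<open>Partial derivatives\<close>

lemma differentiable_linear_compose:
  "bounded_linear L \<Longrightarrow> f differentiable F \<Longrightarrow> (\<lambda>y. L (f y)) differentiable F"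
  unfolding differentiable_def using bounded_linear.has_derivative by blast

lemmas differentiable_has_derivative = iffD1[OF frechet_derivative_works]

lemma partial_eq: "(f has_derivative f') (at x) \<Longrightarrow> partial l f x = f' (axis l 1)"
  unfolding partial_def using frechet_derivative_at[of f f' x] by simp

lemma partial_linear:
  assumes "bounded_linear L" "f differentiable (at x)"
  shows "partial l (\<lambda>y. L (f y)) x = L (partial l f x)"
  using partial_eq[OF bounded_linear.has_derivative[OF assms(1) differentiable_has_derivative[OF assms(2)]]]
  by (simp add: partial_def)

lemma partial_nth:
  "f differentiable (at x) \<Longrightarrow> partial l (\<lambda>y. f y $ k) x = partial l f x $ k"
  by (rule partial_linear[OF bounded_linear_vec_nth])

lemma partial_inner:
  fixes f g :: "real^3 \<Rightarrow> 'b::real_inner"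
  assumes "f differentiable (at x)" "g differentiable (at x)"
  shows "partial l (\<lambda>y. f y \<bullet> g y) x = partial l f x \<bullet> g x + f x \<bullet> partial l g x"
  by (subst partial_eq[OF has_derivative_inner[OF assms[THEN differentiable_has_derivative]]])
    (simp add: partial_def)

lemma partial_diff:
  assumes "f differentiable (at x)" "g differentiable (at x)"
  shows "partial l (\<lambda>y. f y - g y) x = partial l f x - partial l g x"
  by (subst partial_eq[OF has_derivative_diff[OF assms[THEN differentiable_has_derivative]]])
    (simp add: partial_def)

lemma partial_divide:
  fixes f g :: "real^3 \<Rightarrow> real"
  assumes "f differentiable (at x)" "g differentiable (at x)" "g x \<noteq> 0"
  shows "partial l (\<lambda>y. f y / g y) x = (partial l f x * g x - f x * partial l g x) / (g x)\<^sup>2"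
  by (subst partial_eq[OF has_derivative_divide'[OF assms(1,2)[THEN differentiable_has_derivative] assms(3)]])
    (simp add: partial_def power2_eq_square)

text \<open>
  This shows that the resistive energy flux is \<open>\<mu>\<^sub>R \<Sum>\<^sub>k B\<^sub>k (\<partial>\<^sub>l B\<^sub>k - \<partial>\<^sub>k B\<^sub>l)\<close>, the resistive
  induction flux contracted with \<open>B\<close>.
\<close>

lemma lorentz_force_component:
  "cross3 (curl B x) b $ l
   = (\<Sum>k\<in>UNIV. b $ k * (partial k (\<lambda>y. B y $ l) x - partial l (\<lambda>y. B y $ k) x))"
  using exhaust_3[of l] by (auto simp: cross3_def curl_def sum_3 algebra_simps)

section \<open>Regularity of the physical quantities\<close>

lemma state_projections:
  "mass_density = fst" "velocity = (\<lambda>u. (1 / fst u) *\<^sub>R fst (snd u))"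
  "energy = (\<lambda>u. fst (snd (snd u)))" "magnetic = (\<lambda>u. fst (snd (snd (snd u))))"
  "psi = (\<lambda>u. snd (snd (snd (snd u))))"
  by (auto simp: fun_eq_iff mass_density_def velocity_def energy_def magnetic_def psi_def)

lemma state_differentiable:
  assumes "U differentiable (at (x::real^3))" "mass_density (U x) > 0"
  shows "(\<lambda>y. mass_density (U y)) differentiable (at x)"
    "(\<lambda>y. velocity (U y)) differentiable (at x)"
    "(\<lambda>y. pressure \<gamma> (U y)) differentiable (at x)"
    "(\<lambda>y. magnetic (U y)) differentiable (at x)"
    "(\<lambda>y. psi (U y)) differentiable (at x)"
proof -
  have *: "(\<lambda>y. fst (U y)) differentiable (at x)"
     "(\<lambda>y. fst (snd (U y))) differentiable (at x)"
     "(\<lambda>y. fst (snd (snd (U y)))) differentiable (at x)"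
     "(\<lambda>y. fst (snd (snd (snd (U y))))) differentiable (at x)"
     "(\<lambda>y. snd (snd (snd (snd (U y))))) differentiable (at x)"
    using assms(1)
    by (simp_all add: differentiable_linear_compose[OF bounded_linear_fst]
        differentiable_linear_compose[OF bounded_linear_snd])
  show 1: "(\<lambda>y. mass_density (U y)) differentiable (at x)"
    "(\<lambda>y. magnetic (U y)) differentiable (at x)"
    "(\<lambda>y. psi (U y)) differentiable (at x)"
    using * by (simp_all add: state_projections)
  have e: "(\<lambda>y. energy (U y)) differentiable (at x)"
    using * by (simp add: state_projections)
  show 2: "(\<lambda>y. velocity (U y)) differentiable (at x)"
    using * assms(2) by (auto simp: state_projections intro!: differentiable_scaleR differentiable_divide)
  show "(\<lambda>y. pressure \<gamma> (U y)) differentiable (at x)"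
    unfolding pressure_def power2_norm_eq_inner
    by (intro differentiable_mult differentiable_diff differentiable_inner differentiable_divide
        differentiable_power differentiable_const 1 2 e) simp_all
qed

text \<open>
  In this form the entropy is differentiated; it needs both arguments of the logarithm to be positive.
\<close>

lemma specific_entropy_eq:
  assumes "mass_density u > 0" "pressure \<gamma> u > 0"
  shows "specific_entropy \<gamma> u = ln (pressure \<gamma> u) - \<gamma> * ln (mass_density u)"
  using assms by (simp add: specific_entropy_def ln_mult ln_powr)

lemma
  fixes f :: "'a::euclidean_space \<Rightarrow> state"
  assumes V: "open V" and f: "Ck_on k V f" and pos: "\<And>x. x \<in> V \<Longrightarrow> mass_density (f x) > 0"
  shows Ck_on_mass_density: "Ck_on k V (\<lambda>x. mass_density (f x))"
    and Ck_on_velocity: "Ck_on k V (\<lambda>x. velocity (f x))"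
    and Ck_on_magnetic: "Ck_on k V (\<lambda>x. magnetic (f x))"
    and Ck_on_psi: "Ck_on k V (\<lambda>x. psi (f x))"
    and Ck_on_pressure: "Ck_on k V (\<lambda>x. pressure \<gamma> (f x))"
proof -
  show 1: "Ck_on k V (\<lambda>x. mass_density (f x))"
    unfolding state_projections by (intro Ck_on_fst V f)
  have E: "Ck_on k V (\<lambda>x. energy (f x))"
    unfolding state_projections by (intro Ck_on_fst Ck_on_snd V f)
  show 2: "Ck_on k V (\<lambda>x. magnetic (f x))"
    unfolding state_projections by (intro Ck_on_fst Ck_on_snd V f)
  show 3: "Ck_on k V (\<lambda>x. psi (f x))"
    unfolding state_projections by (intro Ck_on_fst Ck_on_snd V f)
  show 4: "Ck_on k V (\<lambda>x. velocity (f x))"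
    unfolding state_projections(2) using pos
    by (intro Ck_on_scaleR Ck_on_divide Ck_on_const Ck_on_fst Ck_on_snd V f) (force simp: mass_density_def case_prod_beta')
  show "Ck_on k V (\<lambda>x. pressure \<gamma> (f x))"
    unfolding pressure_def power2_norm_eq_inner unfolding power2_eq_square
    by (intro Ck_on_mult Ck_on_diff Ck_on_divide Ck_on_inner Ck_on_const V 1 2 3 4 E) auto
qed

lemma
  fixes f :: "'a::euclidean_space \<Rightarrow> state"
  assumes V: "open V" and f: "Ck_on k V f"
    and pos: "\<And>x. x \<in> V \<Longrightarrow> mass_density (f x) > 0 \<and> pressure \<gamma> (f x) > 0" and \<gamma>: "\<gamma> > 1"
  shows Ck_on_entropy_vars: "Ck_on k V (\<lambda>x. entropy_vars \<gamma> (f x))"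
    and Ck_on_entropy_flux: "Ck_on k V (\<lambda>x. entropy_flux \<gamma> (f x))"
proof -
  have r: "\<And>x. x \<in> V \<Longrightarrow> mass_density (f x) > 0" "\<And>x. x \<in> V \<Longrightarrow> mass_density (f x) \<noteq> 0"
    and p: "\<And>x. x \<in> V \<Longrightarrow> pressure \<gamma> (f x) > 0" "\<And>x. x \<in> V \<Longrightarrow> 2 * pressure \<gamma> (f x) \<noteq> 0"
    using pos by force+
  note c = Ck_on_mass_density[OF V f r(1)] Ck_on_velocity[OF V f r(1)] Ck_on_magnetic[OF V f r(1)]
    Ck_on_psi[OF V f r(1)] Ck_on_pressure[OF V f r(1)]
  have "Ck_on k V (\<lambda>x. ln (pressure \<gamma> (f x)) - \<gamma> * ln (mass_density (f x)))"
    by (intro Ck_on_diff Ck_on_mult Ck_on_const Ck_on_ln V c r p)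
  then have s: "Ck_on k V (\<lambda>x. specific_entropy \<gamma> (f x))"
    by (rule Ck_on_cong[OF V]) (simp add: specific_entropy_eq pos)
  show "Ck_on k V (\<lambda>x. entropy_vars \<gamma> (f x))"
    unfolding entropy_vars_def Let_def power2_norm_eq_inner
    by (intro Ck_on_Pair Ck_on_diff Ck_on_mult Ck_on_divide Ck_on_scaleR Ck_on_inner Ck_on_const V s c p)
      (use \<gamma> in auto)
  show "Ck_on k V (\<lambda>x. entropy_flux \<gamma> (f x))"
    unfolding entropy_flux_def entropy_fun_def
    by (intro Ck_on_diff Ck_on_minus Ck_on_mult Ck_on_divide Ck_on_scaleR Ck_on_const V s c) (use \<gamma> in auto)
qed

text \<open>
  The flux contains first derivatives of the state, which cost one order of regularity.
\<close>

lemma Ck_on_viscous_flux: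
  fixes f :: "real^3 \<Rightarrow> state"
  assumes V: "open V" and f: "Ck_on (Suc k) V f" and R: "R > 0"
    and pos: "\<And>x. x \<in> V \<Longrightarrow> mass_density (f x) > 0"
  shows "Ck_on k V (viscous_flux \<gamma> \<mu>NS \<mu>R \<kappa> R l f)"
proof -
  note c = Ck_on_mass_density[OF V f pos] Ck_on_velocity[OF V f pos] Ck_on_magnetic[OF V f pos]
    Ck_on_pressure[OF V f pos]
  note low = c[THEN Ck_on_lower]
  have nz: "R * mass_density (f x) \<noteq> 0" if "x \<in> V" for x using R pos[OF that] by simp
  note p = Ck_on_partial[OF Ck_on_nth[OF V c(2)]] Ck_on_partial[OF Ck_on_nth[OF V c(3)]]
    Ck_on_partial[OF Ck_on_divide[OF V c(4) Ck_on_mult[OF V Ck_on_const[OF V] c(1)] nz]]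
  have st: "Ck_on k V (\<lambda>x. stress \<mu>NS (\<lambda>y. velocity (f y)) x l j)" for j
    unfolding stress_def vdiv_def divergence_def
    by (intro Ck_on_diff Ck_on_mult Ck_on_add Ck_on_sum Ck_on_const V p)
  show ?thesis
    unfolding viscous_flux_def[abs_def] Let_def lorentz_force_component
    by (intro Ck_on_Pair Ck_on_vec_lambda Ck_on_diff Ck_on_mult Ck_on_add Ck_on_sum Ck_on_const V st p Ck_on_nth low)
qed

section \<open>Advective fluxes and the entropy flux\<close>

text \<open>
  With Kronecker deltas and component-wise blocks written as multiples of \<open>v\<close>, \<open>B\<close> and the unit
  vector \<open>e\<close>, the flux can be differentiated and contracted by inner-product rules alone.
\<close>

lemma advective_flux_vector_form:
  "advective_flux \<gamma> c l u =
     (let \<rho> = mass_density u; v = velocity u; p = pressure \<gamma> u; B = magnetic u; \<psi> = psi u; e = axis l 1 in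
       (\<rho> * v $ l,
        (\<rho> * v $ l) *\<^sub>R v + (p + B \<bullet> B / 2) *\<^sub>R e - (B $ l) *\<^sub>R B,
        v $ l * (\<rho> * (v \<bullet> v) / 2 + \<gamma> / (\<gamma> - 1) * p) + v $ l * (B \<bullet> B) - B $ l * (v \<bullet> B) + c * \<psi> * B $ l,
        (v $ l) *\<^sub>R B - (B $ l) *\<^sub>R v + (c * \<psi>) *\<^sub>R e,
        c * B $ l))"
  unfolding advective_flux_def Let_def
  by (simp add: vec_eq_iff axis_def power2_norm_eq_inner algebra_simps)

text \<open>
  Here \<open>w = \<theta> (\<dots>, v, - 1, B, \<psi>)\<close> with \<open>\<theta> = \<rho> / p\<close>.  In the contraction, the magnetic parts of
  the momentum, energy and induction fluxes cancel up to \<open>- \<theta> (v \<bullet> B) \<partial>\<^sub>l B\<^sub>l\<close>, which the second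
  summand compensates; the terms with \<open>c\<close> cancel among each other; and the third summand is
  orthogonal to \<open>w\<close>.  What is left is the hydrodynamic flux, which contracts to the
  derivative of \<open>S v\<^sub>l\<close> as for the Euler equations.  The identity is purely algebraic in the
  values and first derivatives of \<open>\<rho>\<close>, \<open>v\<close>, \<open>p\<close>, \<open>B\<close> and \<open>\<psi>\<close>.
\<close>

lemma advective_entropy_compatibility:
  fixes U :: "real^3 \<Rightarrow> state" and \<gamma> c :: real
  assumes \<gamma>: "\<gamma> > 1" and U: "U differentiable (at x)"
    and pos: "mass_density (U x) > 0" "pressure \<gamma> (U x) > 0"
  shows "entropy_vars \<gamma> (U x) \<bullet>
      (partial l (\<lambda>y. advective_flux \<gamma> c l (U y)) x
       + partial l (\<lambda>y. magnetic (U y) $ l) x *\<^sub>R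
           (0, magnetic (U x), velocity (U x) \<bullet> magnetic (U x), velocity (U x), 0)
       + partial l (\<lambda>y. psi (U y)) x *\<^sub>R
           (0, 0, velocity (U x) $ l * psi (U x), 0, velocity (U x) $ l))
    = partial l (\<lambda>y. entropy_flux \<gamma> (U y) $ l) x"
proof -
  define \<rho> v p B \<psi> where defs: "\<rho> = (\<lambda>y. mass_density (U y))" "v = (\<lambda>y. velocity (U y))"
    "p = (\<lambda>y. pressure \<gamma> (U y))" "B = (\<lambda>y. magnetic (U y))" "\<psi> = (\<lambda>y. psi (U y))"
  obtain \<rho>' v' p' B' \<psi>' where D: "(\<rho> has_derivative \<rho>') (at x)" "(v has_derivative v') (at x)"
    "(p has_derivative p') (at x)" "(B has_derivative B') (at x)" "(\<psi> has_derivative \<psi>') (at x)"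
    using state_differentiable[OF U pos(1)] unfolding defs differentiable_def by metis
  \<comment> \<open>The constants \<open>\<gamma> / (\<gamma> - 1) = 1 + J\<close> and \<open>1 / (\<gamma> - 1) = J\<close>, the density \<open>\<rho> = \<theta> p\<close>
    and \<open>v \<bullet> v = 2 q\<close> are eliminated, so that the final identity is one between polynomials.\<close>
  define K where "K = \<gamma> / (\<gamma> - 1)"
  note Dn = D(2,4)[THEN bounded_linear.has_derivative[OF bounded_linear_vec_nth]]
  define e where "e = (axis l 1 :: real^3)"
  have pos': "\<rho> x > 0" "p x > 0" using pos by (simp_all add: defs)
  have F: "((\<lambda>y. advective_flux \<gamma> c l (U y)) has_derivative (\<lambda>h.
      (\<rho>' h * v x $ l + \<rho> x * v' h $ l,
       (\<rho>' h * v x $ l + \<rho> x * v' h $ l) *\<^sub>R v x + (\<rho> x * v x $ l) *\<^sub>R v' h + (p' h + B x \<bullet> B' h) *\<^sub>R e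
         - (B' h $ l) *\<^sub>R B x - (B x $ l) *\<^sub>R B' h,
       v' h $ l * (\<rho> x * (v x \<bullet> v x) / 2 + K * p x)
         + v x $ l * (\<rho>' h * (v x \<bullet> v x) / 2 + \<rho> x * (v x \<bullet> v' h) + K * p' h)
         + v' h $ l * (B x \<bullet> B x) + v x $ l * (2 * (B x \<bullet> B' h))
         - B' h $ l * (v x \<bullet> B x) - B x $ l * (v' h \<bullet> B x + v x \<bullet> B' h)
         + c * (\<psi>' h * B x $ l + \<psi> x * B' h $ l),
       (v' h $ l) *\<^sub>R B x + (v x $ l) *\<^sub>R B' h - (B' h $ l) *\<^sub>R v x - (B x $ l) *\<^sub>R v' h + (c * \<psi>' h) *\<^sub>R e,
       c * B' h $ l))) (at x)"
    unfolding advective_flux_vector_form Let_def defs[THEN fun_cong, symmetric] e_def[symmetric] K_def[symmetric]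
    by (auto intro!: derivative_eq_intros Dn D
        simp: fun_eq_iff algebra_simps inner_commute)
  define J where "J = 1 / (\<gamma> - 1)"
  have K: "K = 1 + J" "J * \<gamma> = 1 + J" using \<gamma> by (simp_all add: K_def J_def field_simps)
  define \<theta> where "\<theta> = \<rho> x / p x"
  define s where "s = ln (p x) - \<gamma> * ln (\<rho> x)"
  have S: "((\<lambda>y. entropy_flux \<gamma> (U y) $ l) has_derivative (\<lambda>h.
      - J * ((\<rho>' h * s + \<theta> * p' h - \<gamma> * \<rho>' h) * v x $ l + \<rho> x * s * v' h $ l))) (at x)"
  proof (rule has_derivative_transform_eventually)
    show "((\<lambda>y. - J * ((\<rho> y * (ln (p y) - \<gamma> * ln (\<rho> y))) * v y $ l)) has_derivative (\<lambda>h.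
      - J * ((\<rho>' h * s + \<theta> * p' h - \<gamma> * \<rho>' h) * v x $ l + \<rho> x * s * v' h $ l))) (at x)"
      using pos' by (auto intro!: derivative_eq_intros D Dn simp: fun_eq_iff \<theta>_def s_def)
         (simp add: field_simps)
    have "isCont \<rho> x" "isCont p x"
      using D by (auto intro: has_derivative_continuous)
    then have "\<forall>\<^sub>F y in at x. \<rho> y > 0" "\<forall>\<^sub>F y in at x. p y > 0"
      using pos' by (auto simp: isCont_def intro: order_tendstoD)
    then show "\<forall>\<^sub>F y in at x. - J * ((\<rho> y * (ln (p y) - \<gamma> * ln (\<rho> y))) * v y $ l) = entropy_flux \<gamma> (U y) $ l"
      by eventually_elim (simp add: entropy_flux_def entropy_fun_def specific_entropy_eq defs J_def)
    show "- J * ((\<rho> x * (ln (p x) - \<gamma> * ln (\<rho> x))) * v x $ l) = entropy_flux \<gamma> (U x) $ l"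
      using pos by (simp add: entropy_flux_def entropy_fun_def specific_entropy_eq defs J_def)
  qed simp
  have "(\<gamma> - s) / (\<gamma> - 1) = 1 + J * (1 - s)"
    using \<gamma> by (simp add: J_def field_simps)
  moreover have "specific_entropy \<gamma> (U x) = s"
    using pos by (simp add: specific_entropy_eq s_def defs)
  ultimately have w: "entropy_vars \<gamma> (U x) = (1 + J * (1 - s) - \<theta> / 2 * (v x \<bullet> v x), \<theta> *\<^sub>R v x, - \<theta>, \<theta> *\<^sub>R B x, \<theta> * \<psi> x)"
    by (simp add: entropy_vars_def Let_def power2_norm_eq_inner defs \<theta>_def)
  have \<rho>: "\<rho> x = \<theta> * p x" using pos' by (simp add: \<theta>_def)
  have inner_e: "a \<bullet> e = a $ l" "e \<bullet> a = a $ l" for a by (simp_all add: e_def inner_axis inner_axis')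
  have dB: "partial l (\<lambda>y. B y $ l) x = B' e $ l" "partial l \<psi> x = \<psi>' e"
    using partial_eq[OF Dn(2)] partial_eq[OF D(5)] by (simp_all add: e_def)
  define q where "q = v x \<bullet> v x / 2"
  have q: "v x \<bullet> v x = 2 * q" by (simp add: q_def)
  have S': "partial l (\<lambda>y. entropy_flux \<gamma> (U y) $ l) x =
      - J * ((\<rho>' e * s + \<theta> * p' e) * v x $ l + \<rho> x * s * v' e $ l) + (J * \<gamma>) * \<rho>' e * v x $ l"
    unfolding partial_eq[OF S, of l, folded e_def] by (simp add: algebra_simps)
  show ?thesis
    unfolding S'[unfolded K(2)] partial_eq[OF F, of l, folded e_def]
      defs[THEN fun_cong, symmetric] defs[symmetric] dB w K(1) \<rho> q
    by (simp add: inner_e inner_add_right inner_diff_right inner_commute q algebra_simps)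
qed

section \<open>Dissipation by the viscous fluxes\<close>

text \<open>
  The power is a sum of squares: of the off-diagonal part of the symmetrised gradient, and of the
  differences of its diagonal entries, since
  \<open>2 (a\<^sup>2 + b\<^sup>2 + c\<^sup>2) - 2/3 (a + b + c)\<^sup>2 = 2/3 ((a - b)\<^sup>2 + (a - c)\<^sup>2 + (b - c)\<^sup>2)\<close>.
  The factor \<open>2/3\<close> makes the stress trace-free: a uniform expansion dissipates nothing.
\<close>

lemma stress_power_nonneg:
  fixes A :: "3 \<Rightarrow> 3 \<Rightarrow> real"
  assumes "\<mu> \<ge> 0"
  shows "0 \<le> (\<Sum>l\<in>UNIV. \<Sum>k\<in>UNIV.
    (\<mu> * (A l k + A k l) - 2 / 3 * \<mu> * (\<Sum>j\<in>UNIV. A j j) * of_bool (l = k)) * A l k)" (is "0 \<le> ?L")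
proof -
  have "?L = \<mu> * ((A 1 2 + A 2 1)\<^sup>2 + (A 1 3 + A 3 1)\<^sup>2 + (A 2 3 + A 3 2)\<^sup>2
     + 2 / 3 * ((A 1 1 - A 2 2)\<^sup>2 + (A 1 1 - A 3 3)\<^sup>2 + (A 2 2 - A 3 3)\<^sup>2))"
    by (simp add: sum_3 algebra_simps power2_eq_square)
  then show ?thesis using assms by (simp add: add_nonneg_nonneg)
qed

text \<open>
  For \<open>D = \<nabla>B\<close> this sum is \<open>|curl B|\<^sup>2\<close>.
\<close>

lemma antisymmetric_part_power_nonneg:
  fixes D :: "3 \<Rightarrow> 3 \<Rightarrow> real"
  shows "0 \<le> (\<Sum>l\<in>UNIV. \<Sum>k\<in>UNIV. D l k * (D l k - D k l))" (is "0 \<le> ?L")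
proof -
  have "?L = (D 1 2 - D 2 1)\<^sup>2 + (D 1 3 - D 3 1)\<^sup>2 + (D 2 3 - D 3 2)\<^sup>2"
    by (simp add: sum_3 algebra_simps power2_eq_square)
  then show ?thesis by simp
qed

text \<open>
  With \<open>\<theta> = \<rho> / p\<close> and \<open>T = p / (R \<rho>)\<close>: since \<open>w = (\<dots>, \<theta> v, - \<theta>, \<theta> B, \<dots>)\<close>, and the energy
  flux consists of the momentum flux contracted with \<open>v\<close>, the induction flux contracted with \<open>B\<close>
  and the heat flux, all terms that contain \<open>\<partial>\<^sub>l \<theta>\<close> cancel except \<open>- \<kappa> \<partial>\<^sub>l \<theta> \<partial>\<^sub>l T\<close>.  The latter is
  non-negative because \<open>\<theta>\<close> is the reciprocal of \<open>R T\<close>.  The remaining terms are \<open>\<theta>\<close> times the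
  viscous and the resistive power.
\<close>

lemma viscous_entropy_dissipation:
  fixes U :: "real^3 \<Rightarrow> state"
  assumes U: "U differentiable (at x)"
    and pos: "mass_density (U x) > 0" "pressure \<gamma> (U x) > 0"
    and w: "(\<lambda>y. entropy_vars \<gamma> (U y)) differentiable (at x)"
    and coeff: "\<mu>NS \<ge> 0" "\<mu>R \<ge> 0" "\<kappa> \<ge> 0" "R > 0"
  shows "0 \<le> (\<Sum>l\<in>UNIV. partial l (\<lambda>y. entropy_vars \<gamma> (U y)) x \<bullet> viscous_flux \<gamma> \<mu>NS \<mu>R \<kappa> R l U x)"
proof -
  define \<rho> v p B where defs: "\<rho> = (\<lambda>y. mass_density (U y))" "v = (\<lambda>y. velocity (U y))"
    "p = (\<lambda>y. pressure \<gamma> (U y))" "B = (\<lambda>y. magnetic (U y))"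
  have diff: "\<rho> differentiable (at x)" "v differentiable (at x)" "p differentiable (at x)" "B differentiable (at x)"
    using state_differentiable[OF U pos(1)] by (simp_all add: defs)
  have pos': "\<rho> x > 0" "p x > 0" using pos by (simp_all add: defs)
  define \<theta> where "\<theta> = (\<lambda>y. \<rho> y / p y)"
  define T where "T = (\<lambda>y. p y / (R * \<rho> y))"
  define A where "A l k = partial l v x $ k" for l k
  define D where "D l k = partial l B x $ k" for l k
  have \<theta>d: "\<theta> differentiable (at x)"
    using diff pos' unfolding \<theta>_def by (intro differentiable_divide) auto
  have Tl: "partial l T x = (partial l p x * \<rho> x - p x * partial l \<rho> x) / (R * (\<rho> x)\<^sup>2)" for l
    unfolding T_def
    by (subst partial_divide[OF diff(3) differentiable_linear_compose[OF bounded_linear_mult_right diff(1)]])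
      (use pos' coeff(4) partial_linear[OF bounded_linear_mult_right diff(1), where l = l] in
        \<open>auto simp: field_simps power2_eq_square\<close>)
  \<comment> \<open>This is the derivative of \<open>\<theta> = 1 / (R T)\<close>.\<close>
  have \<theta>l: "partial l \<theta> x = - (R * (\<theta> x)\<^sup>2) * partial l T x" for l
  proof -
    have "partial l \<theta> x = (partial l \<rho> x * p x - \<rho> x * partial l p x) / (p x)\<^sup>2"
      unfolding \<theta>_def using pos' by (intro partial_divide diff) simp
    also have "\<dots> = - (R * (\<theta> x)\<^sup>2) * partial l T x"
      using pos' coeff(4) by (simp add: Tl \<theta>_def field_simps power2_eq_square)
    finally show ?thesis .
  qed
  have prod: "partial l (\<lambda>y. \<theta> y *\<^sub>R f y) x = partial l \<theta> x *\<^sub>R f x + \<theta> x *\<^sub>R partial l f x"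
    if "f differentiable (at x)" for l and f :: "real^3 \<Rightarrow> real^3"
    by (subst partial_eq[OF has_derivative_scaleR[OF \<theta>d[THEN differentiable_has_derivative] that[THEN differentiable_has_derivative]]])
      (simp add: partial_def)
  have wc: "fst (snd (entropy_vars \<gamma> (U y))) = \<theta> y *\<^sub>R v y"
    "fst (snd (snd (entropy_vars \<gamma> (U y)))) = - \<theta> y"
    "fst (snd (snd (snd (entropy_vars \<gamma> (U y))))) = \<theta> y *\<^sub>R B y" for y
    by (simp_all add: entropy_vars_def Let_def defs \<theta>_def)
  have bl: "bounded_linear (\<lambda>w. fst (snd w))" "bounded_linear (\<lambda>w. fst (snd (snd w)))"
    "bounded_linear (\<lambda>w. fst (snd (snd (snd w))))"
    by (intro bounded_linear_fst[THEN bounded_linear_compose] bounded_linear_snd[THEN bounded_linear_compose]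
       bounded_linear_fst bounded_linear_snd)+
  have wl: "fst (snd (partial l (\<lambda>y. entropy_vars \<gamma> (U y)) x)) = partial l \<theta> x *\<^sub>R v x + \<theta> x *\<^sub>R partial l v x"
    "fst (snd (snd (partial l (\<lambda>y. entropy_vars \<gamma> (U y)) x))) = - partial l \<theta> x"
    "fst (snd (snd (snd (partial l (\<lambda>y. entropy_vars \<gamma> (U y)) x)))) = partial l \<theta> x *\<^sub>R B x + \<theta> x *\<^sub>R partial l B x" for l
    using partial_linear[OF bl(1) w, of l] partial_linear[OF bl(2) w, of l] partial_linear[OF bl(3) w, of l]
      prod[OF diff(2)] prod[OF diff(4)]
      partial_linear[OF bounded_linear_minus[OF bounded_linear_ident] \<theta>d, of l]
    unfolding wc by simp_all
  have pn: "partial l (\<lambda>y. v y $ k) x = A l k" "partial l (\<lambda>y. B y $ k) x = D l k" for l k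
    by (simp_all add: A_def D_def partial_nth diff)
  define \<tau> where "\<tau> l k = \<mu>NS * (A l k + A k l) - 2 / 3 * \<mu>NS * (\<Sum>j\<in>UNIV. A j j) * of_bool (l = k)" for l k
  have st: "stress \<mu>NS v x l k = \<tau> l k" for l k
    by (simp add: stress_def \<tau>_def vdiv_def divergence_def pn)
  have inner_blocks: "w \<bullet> (0, m, E, b, 0) = fst (snd w) \<bullet> m + fst (snd (snd w)) * E + fst (snd (snd (snd w))) \<bullet> b"
    for w :: state and m E b
    by (simp add: inner_prod_def)
  have "partial l (\<lambda>y. entropy_vars \<gamma> (U y)) x \<bullet> viscous_flux \<gamma> \<mu>NS \<mu>R \<kappa> R l U x
     = \<theta> x * (\<Sum>k\<in>UNIV. \<tau> l k * A l k) + \<kappa> * R * (\<theta> x)\<^sup>2 * (partial l T x)\<^sup>2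
       + \<mu>R * \<theta> x * (\<Sum>k\<in>UNIV. D l k * (D l k - D k l))" for l
  proof -
    have f: "viscous_flux \<gamma> \<mu>NS \<mu>R \<kappa> R l U x = (0, (\<chi> k. \<tau> l k),
        (\<Sum>k\<in>UNIV. \<tau> l k * v x $ k) + \<kappa> * partial l T x
          - \<mu>R * (\<Sum>k\<in>UNIV. B x $ k * (D k l - D l k)),
        (\<chi> k. \<mu>R * (D l k - D k l)), 0)"
      unfolding viscous_flux_def Let_def defs[THEN fun_cong, symmetric] defs[symmetric] T_def
        lorentz_force_component pn st ..
    show ?thesis
      unfolding f inner_blocks wl \<theta>l
      by (simp add: inner_vec_def sum_3 A_def[symmetric] D_def[symmetric] algebra_simps power2_eq_square)
  qed
  then have "(\<Sum>l\<in>UNIV. partial l (\<lambda>y. entropy_vars \<gamma> (U y)) x \<bullet> viscous_flux \<gamma> \<mu>NS \<mu>R \<kappa> R l U x)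
     = \<theta> x * (\<Sum>l\<in>UNIV. \<Sum>k\<in>UNIV. \<tau> l k * A l k) + \<kappa> * R * (\<theta> x)\<^sup>2 * (\<Sum>l\<in>UNIV. (partial l T x)\<^sup>2)
       + \<mu>R * \<theta> x * (\<Sum>l\<in>UNIV. \<Sum>k\<in>UNIV. D l k * (D l k - D k l))"
    by (simp add: sum.distrib sum_distrib_left)
  also have "\<dots> \<ge> 0"
  proof -
    have "0 \<le> (\<Sum>l\<in>UNIV. \<Sum>k\<in>UNIV. \<tau> l k * A l k)"
      unfolding \<tau>_def by (rule stress_power_nonneg[OF coeff(1)])
    moreover have "0 \<le> (\<Sum>l\<in>UNIV. (partial l T x)\<^sup>2)"
      by (simp add: sum_nonneg)
    moreover have "0 < \<theta> x"
      using pos' by (simp add: \<theta>_def)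
    ultimately show ?thesis
      using coeff antisymmetric_part_power_nonneg[of D] by simp
  qed
  finally show ?thesis .
qed

section \<open>The entropy inequality\<close>

text \<open>
  The component \<open>l\<close> contracts the entropy variables with the viscous flux in direction \<open>l\<close>, so that
  the normal component of this field is the integrand of the boundary integral.
\<close>

definition net_entropy_flux :: "real \<Rightarrow> real \<Rightarrow> real \<Rightarrow> real \<Rightarrow> real \<Rightarrow> (real^3 \<Rightarrow> state) \<Rightarrow> real^3 \<Rightarrow> real^3" where
  "net_entropy_flux \<gamma> \<mu>NS \<mu>R \<kappa> R f x =
     (\<chi> l. entropy_flux \<gamma> (f x) $ l - entropy_vars \<gamma> (f x) \<bullet> viscous_flux \<gamma> \<mu>NS \<mu>R \<kappa> R l f x)"

lemma net_entropy_flux_normal: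
  "net_entropy_flux \<gamma> \<mu>NS \<mu>R \<kappa> R f x \<bullet> \<nu>
   = entropy_flux \<gamma> (f x) \<bullet> \<nu>
     - entropy_vars \<gamma> (f x) \<bullet> (\<Sum>l\<in>UNIV. \<nu> $ l *\<^sub>R viscous_flux \<gamma> \<mu>NS \<mu>R \<kappa> R l f x)"
  unfolding inner_sum_right net_entropy_flux_def
  by (simp add: inner_vec_def[of "vec_lambda _"] inner_vec_def[of "entropy_flux _ _"] sum_subtractf algebra_simps)

lemma Ck_on_net_entropy_flux:
  assumes V: "open V" and f: "Ck_on (Suc k) V f" and "\<gamma> > 1" "R > 0"
    and pos: "\<And>x. x \<in> V \<Longrightarrow> mass_density (f x) > 0 \<and> pressure \<gamma> (f x) > 0"
  shows "Ck_on k V (net_entropy_flux \<gamma> \<mu>NS \<mu>R \<kappa> R f)"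
  unfolding net_entropy_flux_def[abs_def]
  using pos assms(3,4)
  by (intro Ck_on_vec_lambda Ck_on_diff Ck_on_inner Ck_on_nth Ck_on_entropy_flux Ck_on_entropy_vars
      Ck_on_viscous_flux Ck_on_lower[OF f] f V) auto

text \<open>
  The vector \<open>ut\<close> stands for the time derivative of the state: apart from it, only the state at a
  single time enters.  Contracting \<open>eq\<close> with \<open>w\<close> turns the advective and the non-conservative terms
  into the divergence of the entropy flux, and what the product rule leaves of the viscous terms is
  the dissipation.
\<close>

lemma pointwise_entropy_inequality:
  fixes f :: "real^3 \<Rightarrow> state" and ut :: state
  assumes \<gamma>: "\<gamma> > 1" and coeff: "\<mu>NS \<ge> 0" "\<mu>R \<ge> 0" "\<kappa> \<ge> 0" "R > 0" "\<alpha> \<ge> 0"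
    and V: "open V" "x \<in> V" and f: "Ck_on 2 V f"
    and pos: "\<And>x. x \<in> V \<Longrightarrow> mass_density (f x) > 0 \<and> pressure \<gamma> (f x) > 0"
    and eq: "ut + divergence (\<lambda>l y. advective_flux \<gamma> c l (f y)) x
      - divergence (\<lambda>l. viscous_flux \<gamma> \<mu>NS \<mu>R \<kappa> R l f) x
      + (nonconservative_MHD f x + nonconservative_GLM f x) = damping_source \<alpha> (f x)"
  shows "entropy_vars \<gamma> (f x) \<bullet> ut + vdiv (net_entropy_flux \<gamma> \<mu>NS \<mu>R \<kappa> R f) x \<le> 0"
proof -
  define w where "w = (\<lambda>y. entropy_vars \<gamma> (f y))"
  define fv where "fv = (\<lambda>l. viscous_flux \<gamma> \<mu>NS \<mu>R \<kappa> R l f)"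
  define fa where "fa = (\<lambda>l y. advective_flux \<gamma> c l (f y))"
  define S where "S = (\<lambda>y. entropy_flux \<gamma> (f y))"
  define \<Upsilon> :: "3 \<Rightarrow> state" where "\<Upsilon> l = partial l (\<lambda>y. magnetic (f y) $ l) x *\<^sub>R
           (0, magnetic (f x), velocity (f x) \<bullet> magnetic (f x), velocity (f x), 0)
       + partial l (\<lambda>y. psi (f y)) x *\<^sub>R
           (0, 0, velocity (f x) $ l * psi (f x), 0, velocity (f x) $ l)" for l
  have f2: "Ck_on (Suc 1) V f" and f1: "Ck_on 1 V f"
    using f Ck_on_lower[of 1 V f] by (simp_all add: numeral_2_eq_2)
  have D: "g differentiable (at x)" if "Ck_on 1 V g" for g :: "real^3 \<Rightarrow> 'z::real_normed_vector"
    using that V(2) by simp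
  have df: "f differentiable (at x)" by (rule D[OF f1])
  have dw: "w differentiable (at x)" unfolding w_def
    by (rule D[OF Ck_on_entropy_vars[OF V(1) f1 pos \<gamma>]])
  have dfv: "fv l differentiable (at x)" for l unfolding fv_def
    by (rule D[OF Ck_on_viscous_flux[OF V(1) f2 coeff(4)]]) (use pos in auto)
  have dS: "S differentiable (at x)" unfolding S_def
    by (rule D[OF Ck_on_entropy_flux[OF V(1) f1 pos \<gamma>]])
  have dn: "(\<lambda>y. S y $ l) differentiable (at x)" for l
    by (rule differentiable_linear_compose[OF bounded_linear_vec_nth dS])
  have dwf: "(\<lambda>y. w y \<bullet> fv l y) differentiable (at x)" for l
    by (rule differentiable_inner[OF dw dfv])
  have px: "mass_density (f x) > 0" "pressure \<gamma> (f x) > 0" using pos V(2) by auto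
  have adv: "w x \<bullet> (partial l (fa l) x + \<Upsilon> l) = partial l (\<lambda>y. S y $ l) x" for l
    using advective_entropy_compatibility[OF \<gamma> df px, of l c]
    by (simp add: w_def fa_def S_def \<Upsilon>_def add.assoc)
  have \<Upsilon>: "nonconservative_MHD f x + nonconservative_GLM f x = (\<Sum>l\<in>UNIV. \<Upsilon> l)"
    by (simp only: nonconservative_MHD_def nonconservative_GLM_def \<Upsilon>_def Let_def vdiv_def
        divergence_def scaleR_sum_left sum.distrib)
  have vd: "vdiv (net_entropy_flux \<gamma> \<mu>NS \<mu>R \<kappa> R f) x
    = (\<Sum>l\<in>UNIV. partial l (\<lambda>y. S y $ l) x) - (\<Sum>l\<in>UNIV. w x \<bullet> partial l (fv l) x) - (\<Sum>l\<in>UNIV. partial l w x \<bullet> fv l x)"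
    unfolding vdiv_def divergence_def net_entropy_flux_def S_def[symmetric, THEN fun_cong] fv_def[symmetric, THEN fun_cong]
       w_def[symmetric, THEN fun_cong]
    by (simp add: partial_diff[OF dn dwf] partial_inner[OF dw dfv] sum_subtractf sum.distrib)
  have r: "w x \<bullet> damping_source \<alpha> (f x) = - \<alpha> * (mass_density (f x) / pressure \<gamma> (f x)) * (psi (f x))\<^sup>2"
    by (simp add: w_def entropy_vars_def damping_source_def Let_def power2_eq_square)
  have "ut = damping_source \<alpha> (f x) - (\<Sum>l\<in>UNIV. partial l (fa l) x + \<Upsilon> l) + (\<Sum>l\<in>UNIV. partial l (fv l) x)"
    using eq unfolding \<Upsilon> divergence_def fa_def[symmetric, THEN fun_cong] fv_def[symmetric, THEN fun_cong]
    by (simp add: sum.distrib fa_def fv_def algebra_simps)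
  then have "w x \<bullet> ut = w x \<bullet> damping_source \<alpha> (f x) - (\<Sum>l\<in>UNIV. partial l (\<lambda>y. S y $ l) x)
      + (\<Sum>l\<in>UNIV. w x \<bullet> partial l (fv l) x)"
    by (simp only: inner_add_right inner_diff_right inner_sum_right adv[unfolded inner_add_right])
  then have "w x \<bullet> ut + vdiv (net_entropy_flux \<gamma> \<mu>NS \<mu>R \<kappa> R f) x
     = - \<alpha> * (mass_density (f x) / pressure \<gamma> (f x)) * (psi (f x))\<^sup>2 - (\<Sum>l\<in>UNIV. partial l w x \<bullet> fv l x)"
    unfolding vd r by simp
  also have "\<dots> \<le> 0"
  proof -
    have "0 \<le> (\<Sum>l\<in>UNIV. partial l w x \<bullet> fv l x)"
      using viscous_entropy_dissipation[OF df px dw[unfolded w_def] coeff(1-4)] by (simp add: w_def fv_def)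
    moreover have "0 \<le> \<alpha> * (mass_density (f x) / pressure \<gamma> (f x)) * (psi (f x))\<^sup>2"
      using px coeff(5) by simp
    ultimately show ?thesis by simp
  qed
  finally show ?thesis by (simp add: w_def)
qed

lemma entropy_time_derivative:
  assumes "\<gamma> > 1" "mass_density (u t x) > 0" "pressure \<gamma> (u t x) > 0"
    and G: "((\<lambda>(\<tau>, x). u \<tau> x) has_derivative G) (at (t, x))"
  shows "vector_derivative (\<lambda>\<tau>. u \<tau> x) (at t) = G (1, 0)"
    and "deriv (\<lambda>\<tau>. entropy_fun \<gamma> (u \<tau> x)) t = entropy_vars \<gamma> (u t x) \<bullet> G (1, 0)"
proof -
  have "((\<lambda>\<tau>. (\<tau>, x)) has_derivative (\<lambda>h. (h, 0))) (at t)"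
    by (auto intro!: derivative_eq_intros)
  from has_derivative_compose[OF this G]
  have ut: "((\<lambda>\<tau>. u \<tau> x) has_derivative (\<lambda>h. G (h, 0))) (at t)" by simp
  have sc: "G (h, 0) = h *\<^sub>R G (1, 0)" for h
    using linear_scale[OF has_derivative_linear[OF G], of h "(1, 0)"] by simp
  show "vector_derivative (\<lambda>\<tau>. u \<tau> x) (at t) = G (1, 0)"
    using ut by (intro vector_derivative_at) (simp add: has_vector_derivative_def flip: sc)
  have "(entropy_fun \<gamma> has_derivative (\<lambda>h. h \<bullet> entropy_vars \<gamma> (u t x))) (at (u t x))"
    using GDERIV_entropy[OF assms(1-3)] by (simp add: gderiv_def)
  moreover have "(\<lambda>h. G (h, 0) \<bullet> entropy_vars \<gamma> (u t x)) = (*) (G (1, 0) \<bullet> entropy_vars \<gamma> (u t x))"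
  proof
    fix h
    show "G (h, 0) \<bullet> entropy_vars \<gamma> (u t x) = (G (1, 0) \<bullet> entropy_vars \<gamma> (u t x)) * h"
      by (subst sc) simp
  qed
  ultimately
  have "((\<lambda>\<tau>. entropy_fun \<gamma> (u \<tau> x)) has_real_derivative (G (1, 0) \<bullet> entropy_vars \<gamma> (u t x))) (at t)"
    using has_derivative_compose[OF ut] by (fastforce simp: has_field_derivative_def)
  then show "deriv (\<lambda>\<tau>. entropy_fun \<gamma> (u \<tau> x)) t = entropy_vars \<gamma> (u t x) \<bullet> G (1, 0)"
    by (simp add: DERIV_imp_deriv inner_commute)
qed

lemma set_integrable_lborel_continuous_closure:
  fixes f :: "'a::euclidean_space \<Rightarrow> real"
  assumes "open \<Omega>" "bounded \<Omega>" "continuous_on (closure \<Omega>) f"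
  shows "set_integrable lborel \<Omega> f"
proof (rule set_integrable_subset)
  show "set_integrable lborel (closure \<Omega>) f"
    unfolding set_integrable_def using assms by (intro borel_integrable_compact) auto
qed (use assms closure_subset in auto)

theorem theorem1:
  fixes \<Omega> :: "(real^3) set" and n :: "real^3 \<Rightarrow> real^3"
    and T :: "real set" and U :: "(real^3) set"
    and u :: "real \<Rightarrow> real^3 \<Rightarrow> state"
    and \<gamma> c\<^sub>h \<mu>\<^sub>N\<^sub>S \<mu>\<^sub>R \<kappa> R \<alpha> t :: real
  assumes "\<gamma> > 1" and "\<mu>\<^sub>N\<^sub>S > 0" and "\<mu>\<^sub>R > 0" and "\<kappa> > 0" and "R > 0" and "\<alpha> \<ge> 0"
    and "open \<Omega>" and "connected \<Omega>" and "bounded \<Omega>"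
    and "outward_unit_normal \<Omega> n" and "divergence_theorem_holds \<Omega> n"
    and "open T" and "open U" and "closure \<Omega> \<subseteq> U"
    and smooth: "Ck_on 2 (T \<times> U) (\<lambda>(\<tau>, x). u \<tau> x)"
    and positive: "\<And>\<tau> x. \<tau> \<in> T \<Longrightarrow> x \<in> closure \<Omega> \<Longrightarrow>
                     mass_density (u \<tau> x) > 0 \<and> pressure \<gamma> (u \<tau> x) > 0"
    and solution: "\<And>\<tau> x. \<tau> \<in> T \<Longrightarrow> x \<in> \<Omega> \<Longrightarrow>
                     resistive_GLM_MHD_at \<gamma> c\<^sub>h \<mu>\<^sub>N\<^sub>S \<mu>\<^sub>R \<kappa> R \<alpha> u \<tau> x"
    and "t \<in> T"
  shows "(LINT x:\<Omega>|lborel. deriv (\<lambda>\<tau>. entropy_fun \<gamma> (u \<tau> x)) t)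
       + (LINT x:frontier \<Omega>|surface_measure.
            entropy_flux \<gamma> (u t x) \<bullet> n x
            - entropy_vars \<gamma> (u t x) \<bullet>
                (\<Sum>l\<in>UNIV. n x $ l *\<^sub>R viscous_flux \<gamma> \<mu>\<^sub>N\<^sub>S \<mu>\<^sub>R \<kappa> R l (u t) x)) \<le> 0"
proof -
  define G where "G x = frechet_derivative (\<lambda>(\<tau>, x). u \<tau> x) (at (t, x))" for x
  define F where "F = net_entropy_flux \<gamma> \<mu>\<^sub>N\<^sub>S \<mu>\<^sub>R \<kappa> R (u t)"
  \<comment> \<open>Positivity is only given on the closure of the domain; by continuity it persists on the
    open set \<open>V\<close> around it, which the divergence theorem needs. The density comes first,
    since the pressure is only known to be continuous where the density does not vanish.\<close>
  define V1 where "V1 = {x \<in> U. mass_density (u t x) > 0}"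
  define V where "V = {x \<in> V1. pressure \<gamma> (u t x) > 0}"
  have smooth': "Ck_on (Suc 1) (T \<times> U) (\<lambda>(\<tau>, x). u \<tau> x)"
    using smooth by (simp add: numeral_2_eq_2)
  have fU: "Ck_on 2 U (u t)"
    using Ck_on_slice[OF \<open>open U\<close> \<open>t \<in> T\<close> smooth] by simp
  have V1: "open V1"
  proof -
    have "continuous_on U (\<lambda>x. mass_density (u t x))"
      using Ck_on_continuous[OF Ck_on_fst[OF \<open>open U\<close> fU]]
      by (simp add: mass_density_def case_prod_beta')
    from continuous_open_preimage[OF this \<open>open U\<close> open_greaterThan[of 0]]
    show ?thesis by (rule back_subst[where P = "open"]) (auto simp: V1_def)
  qed
  have fV1: "Ck_on 2 V1 (u t)"
    using fU by (rule Ck_on_subset) (auto simp: V1_def)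
  have "continuous_on V1 (\<lambda>x. pressure \<gamma> (u t x))"
    by (rule Ck_on_continuous[OF Ck_on_pressure[OF V1 fV1]]) (auto simp: V1_def)
  from continuous_open_preimage[OF this V1 open_greaterThan[of 0]]
  have V: "open V" by (rule back_subst[where P = "open"]) (auto simp: V_def)
  have fV: "Ck_on 2 V (u t)"
    using fV1 by (rule Ck_on_subset) (auto simp: V_def)
  have sub: "closure \<Omega> \<subseteq> V"
    using positive[OF \<open>t \<in> T\<close>] \<open>closure \<Omega> \<subseteq> U\<close> by (auto simp: V_def V1_def)
  have pos: "mass_density (u t x) > 0 \<and> pressure \<gamma> (u t x) > 0" if "x \<in> V" for x
    using that by (simp add: V_def V1_def)
  have F: "Ck_on 1 V F"
    unfolding F_def using Ck_on_net_entropy_flux[OF V _ \<open>\<gamma> > 1\<close> \<open>R > 0\<close> pos, of 1] fV by (simp add: numeral_2_eq_2)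
  have Gx: "((\<lambda>(\<tau>, x). u \<tau> x) has_derivative G x) (at (t, x))" if "x \<in> V" for x
    unfolding G_def using that \<open>t \<in> T\<close> by (intro Ck_on_has_derivative[OF smooth']) (auto simp: V_def V1_def)
  have St: "deriv (\<lambda>\<tau>. entropy_fun \<gamma> (u \<tau> x)) t = entropy_vars \<gamma> (u t x) \<bullet> G x (1, 0)"
    and ut: "vector_derivative (\<lambda>\<tau>. u \<tau> x) (at t) = G x (1, 0)" if "x \<in> V" for x
    using entropy_time_derivative[of \<gamma> u t x "G x"] \<open>\<gamma> > 1\<close> pos[OF that] Gx[OF that] by auto
  have "continuous_on V (\<lambda>x. G x (1, 0))"
  proof -
    have "(1, 0) \<in> (Basis :: (real \<times> (real^3)) set)" by (simp add: Basis_prod_def)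
    with smooth' have "Ck_on 1 (T \<times> U) (\<lambda>z. frechet_derivative (\<lambda>(\<tau>, x). u \<tau> x) (at z) (1, 0))"
      by simp
    from Ck_on_continuous[OF Ck_on_slice[OF \<open>open U\<close> \<open>t \<in> T\<close> this]]
    show ?thesis unfolding G_def by (rule continuous_on_subset) (auto simp: V_def V1_def)
  qed
  then have "continuous_on V (\<lambda>x. entropy_vars \<gamma> (u t x) \<bullet> G x (1, 0))"
    by (intro continuous_on_inner Ck_on_continuous[OF Ck_on_entropy_vars[OF V fV pos \<open>\<gamma> > 1\<close>]])
  from continuous_on_subset[OF this sub]
  have "continuous_on (closure \<Omega>) (\<lambda>x. deriv (\<lambda>\<tau>. entropy_fun \<gamma> (u \<tau> x)) t)"
    by (rule continuous_on_eq) (simp add: St subsetD[OF sub])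
  then have int1: "set_integrable lborel \<Omega> (\<lambda>x. deriv (\<lambda>\<tau>. entropy_fun \<gamma> (u \<tau> x)) t)"
    by (rule set_integrable_lborel_continuous_closure[OF \<open>open \<Omega>\<close> \<open>bounded \<Omega>\<close>])
  have "Ck_on (Suc 0) V (\<lambda>y. F y $ l)" for l
    using Ck_on_nth[OF V F] by simp
  from Ck_on_continuous[OF Ck_on_partial[OF this]]
  have "continuous_on V (vdiv F)"
    unfolding vdiv_def divergence_def[abs_def] by (intro continuous_intros)
  then have int2: "set_integrable lborel \<Omega> (vdiv F)"
    using sub by (intro set_integrable_lborel_continuous_closure \<open>open \<Omega>\<close> \<open>bounded \<Omega>\<close>) (rule continuous_on_subset)
  have "(LINT x:frontier \<Omega>|surface_measure. entropy_flux \<gamma> (u t x) \<bullet> n x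
            - entropy_vars \<gamma> (u t x) \<bullet> (\<Sum>l\<in>UNIV. n x $ l *\<^sub>R viscous_flux \<gamma> \<mu>\<^sub>N\<^sub>S \<mu>\<^sub>R \<kappa> R l (u t) x))
      = (LINT x:\<Omega>|lborel. vdiv F x)"
    using \<open>divergence_theorem_holds \<Omega> n\<close> V sub F
    unfolding divergence_theorem_holds_def F_def net_entropy_flux_normal[symmetric] by metis
  moreover have "(LINT x:\<Omega>|lborel. deriv (\<lambda>\<tau>. entropy_fun \<gamma> (u \<tau> x)) t) + (LINT x:\<Omega>|lborel. vdiv F x)
      = (LINT x:\<Omega>|lborel. deriv (\<lambda>\<tau>. entropy_fun \<gamma> (u \<tau> x)) t + vdiv F x)"
    by (rule set_integral_add(2)[OF int1 int2, symmetric])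
  moreover have "\<dots> \<le> (LINT x:\<Omega>|lborel. 0)"
  proof (rule set_integral_mono)
    fix x assume x: "x \<in> \<Omega>"
    then have xV: "x \<in> V" using sub closure_subset by auto
    show "deriv (\<lambda>\<tau>. entropy_fun \<gamma> (u \<tau> x)) t + vdiv F x \<le> 0"
      unfolding St[OF xV] F_def
    proof (rule pointwise_entropy_inequality)
      show "G x (1, 0) + divergence (\<lambda>l y. advective_flux \<gamma> c\<^sub>h l (u t y)) x
          - divergence (\<lambda>l. viscous_flux \<gamma> \<mu>\<^sub>N\<^sub>S \<mu>\<^sub>R \<kappa> R l (u t)) x
          + (nonconservative_MHD (u t) x + nonconservative_GLM (u t) x) = damping_source \<alpha> (u t x)"
        using solution[OF \<open>t \<in> T\<close> x] unfolding resistive_GLM_MHD_at_def ut[OF xV] .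
    qed (use assms V xV fV pos in auto)
  next
    show "set_integrable lborel \<Omega> (\<lambda>x. deriv (\<lambda>\<tau>. entropy_fun \<gamma> (u \<tau> x)) t + vdiv F x)"
      by (rule set_integral_add(1)[OF int1 int2])
    show "set_integrable lborel \<Omega> (\<lambda>x. 0 :: real)"
      by (simp add: set_integrable_def)
  qed
  ultimately show ?thesis by (simp add: set_lebesgue_integral_def)
qed

end
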